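(* Let $p$ be a prime, let $a\in\mathbb{C}_p$ with $a\neq 0$, and let $f(x)=\frac{a}{x^2}$ for $x\in\mathbb{C}_p\setminus\{0\}$. Then for every $x\in\mathbb{C}_p\setminus\{0\}$ and every integer $n\geq 1$, $$f^n(x)=a^{\frac13\left(1-(-2)^n\right)}\cdot x^{(-2)^n}.$$
   Context: $\mathbb{C}_p$ denotes the field of complex $p$-adic numbers (the completion of the algebraic closure of $\mathbb{Q}_p$). $f^n$ denotes the $n$-fold composition of $f$ with itself; $f$ maps $\mathbb{C}_p\setminus\{0\}$ to itself. The exponent $\frac13(1-(-2)^n)$ is an integer. *)

theory Defs
  imports "HOL-Analysis.Analysis" "HOL-Algebra.Algebraic_Closure_Type"
begin

definition padic_abs :: "nat \<Rightarrow> rat \<Rightarrow> real" where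
  "padic_abs p q =
     (if q = 0 then 0
      else real p powi (int (multiplicity (int p) (snd (quotient_of q)))
                        - int (multiplicity (int p) (fst (quotient_of q)))))"

definition absolute_value :: "('k::field \<Rightarrow> real) \<Rightarrow> bool" where
  "absolute_value v \<longleftrightarrow>
     (\<forall>x. 0 \<le> v x) \<and> (\<forall>x. v x = 0 \<longleftrightarrow> x = 0) \<and>
     (\<forall>x y. v (x * y) = v x * v y) \<and> (\<forall>x y. v (x + y) \<le> v x + v y)"

abbreviation abs_dist :: "('k::field \<Rightarrow> real) \<Rightarrow> 'k \<Rightarrow> 'k \<Rightarrow> real" where
  "abs_dist v \<equiv> \<lambda>x y. v (x - y)"

lemma Metric_space_abs_dist:
  assumes "absolute_value v"
  shows "Metric_space M (abs_dist v)"
proof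
  have mult: "v (a * b) = v a * v b" and tri: "v (a + b) \<le> v a + v b"
    and zero: "v a = 0 \<longleftrightarrow> a = 0" and nonneg: "0 \<le> v a" for a b
    using assms by (auto simp: absolute_value_def)
  have "v (- 1) * v (- 1) = 1" "v 1 * v 1 = v 1" "v 1 \<noteq> 0"
    using mult[of "- 1" "- 1"] mult[of 1 1] mult[of 1] zero[of 1] by auto
  then have "v (- 1) = 1"
    using nonneg[of "- 1"] by (metis abs_of_nonneg abs_mult_self_eq abs_1 power2_eq_1_iff
        power2_eq_square abs_minus_cancel)
  then have minus: "v (- a) = v a" for a
    using mult[of "- 1" a] by simp
  show "0 \<le> abs_dist v x y" for x y by (rule nonneg)
  show "abs_dist v x y = abs_dist v y x" for x y using minus[of "x - y"] by simp
  show "abs_dist v x y = 0 \<longleftrightarrow> x = y" for x y using zero[of "x - y"] by simp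
  show "abs_dist v x z \<le> abs_dist v x y + abs_dist v y z" for x y z
    using tri[of "x - y" "y - z"] by simp
qed

text \<open>
  Completions and algebraic closures are formed inside one ambient valued field;
  a subset of that field stands for the valued field it carries.
\<close>

definition is_completion :: "('k::field \<Rightarrow> real) \<Rightarrow> 'k set \<Rightarrow> 'k set \<Rightarrow> bool" where
  "is_completion v A B \<longleftrightarrow>
     subfield A ring_of_type_algebra \<and> subfield B ring_of_type_algebra \<and> A \<subseteq> B \<and>
     Metric_space.mcomplete B (abs_dist v) \<and>
     Metric_space.mtopology B (abs_dist v) closure_of A = B"

definition is_algebraic_closure :: "'k::field set \<Rightarrow> 'k set \<Rightarrow> bool" where
  "is_algebraic_closure A B \<longleftrightarrow>
     subfield B ring_of_type_algebra \<and>
     algebraic_closure (ring_of_type_algebra\<lparr>carrier := B\<rparr>) A"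

text \<open>
  \<open>complex_padic_field p v\<close>: the type \<open>'k\<close> with the absolute value \<open>v\<close> is the field of complex
  \<open>p\<close>-adic numbers, that is, a completion of an algebraic closure \<open>L\<close> of a completion \<open>Q\<close> of the
  rationals under the \<open>p\<close>-adic absolute value. This determines \<open>('k, v)\<close> up to isometric
  isomorphism, because the absolute value of \<open>Q\<close> extends uniquely to \<open>L\<close>.
\<close>

definition complex_padic_field :: "nat \<Rightarrow> ('k::field_char_0 \<Rightarrow> real) \<Rightarrow> bool" where
  "complex_padic_field p v \<longleftrightarrow>
     absolute_value v \<and> (\<forall>q. v (of_rat q) = padic_abs p q) \<and>
     (\<exists>Q L. is_completion v \<rat> Q \<and> is_algebraic_closure Q L \<and> is_completion v L UNIV)"

text \<open>The integer division \<open>(1 - (- 2) ^ n) div 3\<close> is exact:\<close>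

lemma three_dvd_one_minus_power: "(3::int) dvd 1 - (- 2) ^ n"
proof (induction n)
  case (Suc n)
  have "1 - (- 2) ^ Suc n = 3 - 2 * (1 - (- 2 :: int) ^ n)" by simp
  then show ?case using Suc by (metis dvd_diff dvd_mult dvd_refl)
qed simp

end

theory Submission
  imports Defs
begin

text \<open>
  Composing \<open>x \<mapsto> a / x\<^sup>2\<close> with a monomial \<open>a\<^sup>e x\<^sup>m\<close> gives the monomial with exponents
  \<open>1 - 2 e\<close> and \<open>- 2 m\<close>. Starting from the identity, where \<open>(e, m) = (0, 1)\<close>, the exponent of
  \<open>x\<close> is therefore \<open>(- 2)\<^sup>n\<close>, and the exponent of \<open>a\<close> is the geometric sum
  \<open>1 + (- 2) + \<dots> + (- 2)\<^sup>n\<^sup>-\<^sup>1 = (1 - (- 2)\<^sup>n) / 3\<close>.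
\<close>

text \<open>
  Both divisions are exact, so this is Horner's rule for the geometric sum
  \<open>1 + (- 2) + \<dots> + (- 2)\<^sup>n\<close>; rounding by \<open>div\<close> would destroy it.
\<close>

lemma one_minus_power_div_three_Suc:
  "(1 - (- 2 :: int) ^ Suc n) div 3 = 1 - 2 * ((1 - (- 2) ^ n) div 3)"
proof -
  obtain k :: int where "1 - (- 2) ^ n = 3 * k"
    using three_dvd_one_minus_power[of n] by (auto elim: dvdE)
  moreover from this have "1 - (- 2 :: int) ^ Suc n = 3 * (1 - 2 * k)"
    by simp
  ultimately show ?thesis
    by (simp del: power_Suc)
qed

lemma divide_monomial_square:
  fixes a x :: "'k::field"
  assumes "a \<noteq> 0"
  shows "a / (a powi e * x powi m) ^ 2 = a powi (1 - 2 * e) * x powi (- 2 * m)"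
proof -
  have "(y powi k) ^ 2 = y powi (2 * k)" for y :: 'k and k :: int
    by (simp add: power_int_mult power_int_power mult.commute)
  then show ?thesis
    using assms
    by (simp add: power_int_diff power_int_minus power_mult_distrib divide_inverse mult_ac)
qed

lemma funpow_divide_square:
  fixes a x :: "'k::field"
  assumes a: "a \<noteq> 0" and x: "x \<noteq> 0"
    and f: "\<And>y. y \<noteq> 0 \<Longrightarrow> f y = a / y ^ 2"
  shows "(f ^^ n) x = a powi ((1 - (- 2) ^ n) div 3) * x powi ((- 2) ^ n)"
proof (induction n)
  case 0
  show ?case by simp
next
  case (Suc n)
  let ?e = "(1 - (- 2 :: int) ^ n) div 3" and ?m = "(- 2 :: int) ^ n"
  have "(f ^^ Suc n) x = f (a powi ?e * x powi ?m)"
    by (simp add: Suc)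
  also have "\<dots> = a / (a powi ?e * x powi ?m) ^ 2"
    using a x by (intro f) simp
  also have "\<dots> = a powi (1 - 2 * ?e) * x powi (- 2 * ?m)"
    by (rule divide_monomial_square[OF a])
  finally show ?case
    unfolding one_minus_power_div_three_Suc by simp
qed

theorem lemma1:
  fixes p :: nat and v :: "'k::field_char_0 \<Rightarrow> real"
    and a :: 'k and f :: "'k \<Rightarrow> 'k"
  assumes "Factorial_Ring.prime p"
    and "complex_padic_field p v"
    and "a \<noteq> 0"
    and "\<And>x. x \<noteq> 0 \<Longrightarrow> f x = a / x ^ 2"
  shows "\<forall>x n. x \<noteq> 0 \<longrightarrow> 1 \<le> n \<longrightarrow>
           (f ^^ n) x = a powi ((1 - (- 2) ^ n) div 3) * x powi ((- 2) ^ n)"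
  using funpow_divide_square[OF assms(3) _ assms(4)] by blast

end
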